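(* Let $\mathcal R,\mathcal F$ be quasi-orders. Suppose $\mathcal F$ is better-quasi-ordered, and there is an immersion $m:\mathcal R\to H^*_{\omega_1}(\mathcal F)$. Then $\mathcal R$ is better-quasi-ordered.
   Context: An immersion between quasi-orders $(Q,\leq)$ and $(R,\preceq)$ is a map $f:Q\to R$ such that $f(p)\preceq f(q)$ implies $p\leq q$ for all $p,q\in Q$. A quasi-order $(Q,\leq)$ is well-quasi-ordered (WQO) if for every sequence $(q_n)_{n\in\mathbb N}$ in $Q$ there are $i<j$ with $q_i\leq q_j$. Let $(Q,\le)$ be a quasi-order, whose elements are regarded as atoms (not as sets). For a set $A$ let $\mathcal P^*(A)$ be the set of non-empty subsets of $A$. Define $V^*_0(Q):=Q$, $V^*_{\alpha+1}(Q):=\mathcal P^*(V^*_\alpha(Q))$, and $V^*_\alpha(Q):=\bigcup_{\beta<\alpha}V^*_\beta(Q)$ for limit $\alpha$; let $V^*(Q)=\bigcup_\alpha V^*_\alpha(Q)$. Each element of $Q$ is hereditarily countable, and recursively a set $X\in V^*(Q)$ is hereditarily countable if it is a countable set of hereditarily countable elements. Define $\leq_+$ on $V^*(Q)$ recursively; it holds exactly in the following cases: if $X,Y\in Q$, then $X\leq_+Y$ iff $X\leq Y$ in $Q$; if $X\in Q$, $Y\notin Q$, then $X\leq_+Y$ iff there is $Y'\in Y$ with $X\leq_+Y'$; if $X\notin Q$, $Y\notin Q$, then $X\leq_+Y$ iff for every $X'\in X$ there is $Y'\in Y$ with $X'\leq_+Y'$. Let $H^*_{\omega_1}(Q)$ be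 the set of hereditarily countable elements of $V^*_{\omega_1}(Q)$ equipped with $\leq_+$. The quasi-order $Q$ is better-quasi-ordered if $H^*_{\omega_1}(Q)$ is WQO. (This is equivalent to Nash-Williams' original definition and is used as the definition.) *)

theory Defs
  imports "HOL-Library.Countable_Set_Type" "HOL-Library.FuncSet"
begin

definition quasi_order_on :: "'a set \<Rightarrow> ('a \<Rightarrow> 'a \<Rightarrow> bool) \<Rightarrow> bool" where
  "quasi_order_on Q le \<longleftrightarrow> reflp_on Q le \<and> transp_on Q le"

definition wqo_on :: "'a set \<Rightarrow> ('a \<Rightarrow> 'a \<Rightarrow> bool) \<Rightarrow> bool" where
  "wqo_on Q le \<longleftrightarrow> quasi_order_on Q le \<and>
     (\<forall>q :: nat \<Rightarrow> 'a. (\<forall>n. q n \<in> Q) \<longrightarrow> (\<exists>i j. i < j \<and> le (q i) (q j)))"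

definition immersion ::
  "'a set \<Rightarrow> ('a \<Rightarrow> 'a \<Rightarrow> bool) \<Rightarrow> 'b set \<Rightarrow> ('b \<Rightarrow> 'b \<Rightarrow> bool) \<Rightarrow> ('a \<Rightarrow> 'b) \<Rightarrow> bool" where
  "immersion Q leQ R leR f \<longleftrightarrow>
     f \<in> Q \<rightarrow> R \<and> (\<forall>p\<in>Q. \<forall>q\<in>Q. leR (f p) (f q) \<longrightarrow> leQ p q)"

text \<open>
  The full hierarchy of iterated power sets over \<open>Q\<close> up to \<open>\<omega>\<^sub>1\<close> does not fit into a HOL type, but its
  hereditarily countable part does: the elements of the following type are the atoms and,
  recursively, the countable sets of elements of the type. Sets are extensional, since \<^typ>\<open>'a cset\<close>
  is, and an atom is never a set. The empty set is excluded only in the hierarchy below.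
\<close>

datatype 'a hcset = Atom 'a | Set "'a hcset cset"

text \<open>
  The well-order \<open>omega1\<close> is the first uncountable ordinal; the elements of its field play the role
  of the countable ordinals.
\<close>

abbreviation omega1 :: "nat set rel" where
  "omega1 \<equiv> cardSuc natLeq"

definition is_zero :: "nat set \<Rightarrow> bool" where
  "is_zero \<alpha> \<longleftrightarrow> \<alpha> \<in> Field omega1 \<and> underS omega1 \<alpha> = {}"

definition is_succ :: "nat set \<Rightarrow> nat set \<Rightarrow> bool" where
  "is_succ \<beta> \<alpha> \<longleftrightarrow> \<beta> \<in> Field omega1 \<and> \<alpha> \<in> Field omega1 \<and> underS omega1 \<alpha> = under omega1 \<beta>"

definition is_limit :: "nat set \<Rightarrow> bool" where
  "is_limit \<alpha> \<longleftrightarrow> \<alpha> \<in> Field omega1 \<and> \<not> is_zero \<alpha> \<and> (\<nexists>\<beta>. is_succ \<beta> \<alpha>)"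

text \<open>
  \<open>HV Q \<alpha>\<close> is the set of hereditarily countable elements of \<open>V\<^sup>*\<^sub>\<alpha>(Q)\<close>, for \<open>\<alpha> < \<omega>\<^sub>1\<close>. In the last case,
  the union ranges over the unique predecessor of \<open>\<alpha>\<close>, see \<open>HV_succ\<close> below.
\<close>

function HV :: "'a set \<Rightarrow> nat set \<Rightarrow> 'a hcset set" where
  "HV Q \<alpha> =
     (if is_zero \<alpha> then Atom ` Q
      else if is_limit \<alpha> then \<Union>\<beta>\<in>underS omega1 \<alpha>. HV Q \<beta>
      else \<Union>\<beta>\<in>{\<beta>. is_succ \<beta> \<alpha>}. {Set X |X. rcset X \<noteq> {} \<and> rcset X \<subseteq> HV Q \<beta>})"
  by pat_completeness auto

lemma Card_order_omega1: "Card_order omega1"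
  by (simp add: cardSuc_Card_order natLeq_Card_order)

lemma Well_order_omega1: "Well_order omega1"
  using Card_order_omega1 card_order_on_well_order_on by blast

interpretation omega1: wo_rel omega1
  by unfold_locales (rule Well_order_omega1)

lemma is_succ_underS: "is_succ \<beta> \<alpha> \<Longrightarrow> \<beta> \<in> underS omega1 \<alpha>"
  using omega1.REFL by (auto simp: is_succ_def under_def refl_on_def)

termination
  by (relation "inv_image (omega1 - Id) snd")
    (use omega1.WF is_succ_underS in \<open>auto simp: underS_def\<close>)

declare HV.simps [simp del]

definition H_omega1 :: "'a set \<Rightarrow> 'a hcset set" where
  "H_omega1 Q = (\<Union>\<alpha>\<in>Field omega1. HV Q \<alpha>)"

text \<open>
  No clause relates a set to an atom. As the element relation is well-founded, the least relation
  closed under these rules is the recursively defined one; see \<open>le_plus_simps\<close>.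
\<close>

inductive le_plus :: "('a \<Rightarrow> 'a \<Rightarrow> bool) \<Rightarrow> 'a hcset \<Rightarrow> 'a hcset \<Rightarrow> bool"
  for le :: "'a \<Rightarrow> 'a \<Rightarrow> bool" where
  atom_atom: "le p q \<Longrightarrow> le_plus le (Atom p) (Atom q)"
| atom_set: "\<exists>y\<in>rcset Y. le_plus le (Atom p) y \<Longrightarrow> le_plus le (Atom p) (Set Y)"
| set_set: "\<forall>x\<in>rcset X. \<exists>y\<in>rcset Y. le_plus le x y \<Longrightarrow> le_plus le (Set X) (Set Y)"

definition bqo_on :: "'a set \<Rightarrow> ('a \<Rightarrow> 'a \<Rightarrow> bool) \<Rightarrow> bool" where
  "bqo_on Q le \<longleftrightarrow> quasi_order_on Q le \<and> wqo_on (H_omega1 Q) (le_plus le)"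

lemma le_plus_simps [simp]:
  "le_plus le (Atom p) (Atom q) \<longleftrightarrow> le p q"
  "le_plus le (Atom p) (Set Y) \<longleftrightarrow> (\<exists>y\<in>rcset Y. le_plus le (Atom p) y)"
  "le_plus le (Set X) (Set Y) \<longleftrightarrow> (\<forall>x\<in>rcset X. \<exists>y\<in>rcset Y. le_plus le x y)"
  "\<not> le_plus le (Set X) (Atom q)"
  by (subst le_plus.simps; blast)+

lemma is_succ_unique: "is_succ \<beta> \<alpha> \<Longrightarrow> is_succ \<beta>' \<alpha> \<Longrightarrow> \<beta> = \<beta>'"
  using omega1.REFL omega1.ANTISYM
  unfolding is_succ_def under_def refl_on_def antisym_def by blast

lemma HV_zero: "is_zero \<alpha> \<Longrightarrow> HV Q \<alpha> = Atom ` Q"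
  by (simp add: HV.simps)

lemma HV_succ:
  assumes "is_succ \<beta> \<alpha>"
  shows "HV Q \<alpha> = {Set X |X. rcset X \<noteq> {} \<and> rcset X \<subseteq> HV Q \<beta>}"
proof -
  have "{\<beta>. is_succ \<beta> \<alpha>} = {\<beta>}" "\<not> is_zero \<alpha>" "\<not> is_limit \<alpha>"
    using assms is_succ_unique is_succ_underS unfolding is_limit_def is_zero_def by blast+
  then show ?thesis by (subst HV.simps) simp
qed

lemma HV_limit: "is_limit \<alpha> \<Longrightarrow> HV Q \<alpha> = (\<Union>\<beta>\<in>underS omega1 \<alpha>. HV Q \<beta>)"
  by (subst HV.simps) (simp add: is_limit_def)

lemma countable_bounded_omega1:
  assumes "A \<subseteq> Field omega1" "countable A"
  shows "\<exists>\<gamma>\<in>Field omega1. A \<subseteq> underS omega1 \<gamma>"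
proof (rule ccontr)
  assume neg: "\<not> ?thesis"
  have nofin: "infinite (Field omega1)"
    using cardSuc_finite[OF natLeq_Card_order] infinite_UNIV_nat by (simp only: Field_natLeq not_False_eq_True)
  have "cofinal A omega1"
    unfolding cofinal_def
  proof
    fix \<gamma> assume \<gamma>: "\<gamma> \<in> Field omega1"
    then obtain \<delta> where \<delta>: "\<delta> \<in> Field omega1" "\<gamma> \<noteq> \<delta>" "(\<gamma>, \<delta>) \<in> omega1"
      using infinite_Card_order_limit[OF Card_order_omega1 nofin] by blast
    then obtain a where "a \<in> A" "a \<notin> underS omega1 \<delta>"
      using neg by blast
    moreover from this have "(\<delta>, a) \<in> omega1"
      using assms(1) \<delta>(1) omega1.TOTALS omega1.REFL unfolding underS_def refl_on_def by blast
    moreover from this have "(\<gamma>, a) \<in> omega1"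
      using \<delta>(3) omega1.TRANS by (blast dest: transD)
    moreover have "\<gamma> \<noteq> a"
      using \<delta> \<open>(\<delta>, a) \<in> omega1\<close> omega1.ANTISYM by (blast dest: antisymD)
    ultimately show "\<exists>b\<in>A. \<gamma> \<noteq> b \<and> (\<gamma>, b) \<in> omega1" by blast
  qed
  then have "(card_of A, omega1) \<in> ordIso"
    using infinite_cardSuc_regularCard[of natLeq] assms(1) natLeq_Card_order
    by (auto simp: regularCard_def Field_natLeq)
  moreover have "(card_of A, omega1) \<in> ordLess"
    using assms(2) cardSuc_greater[OF natLeq_Card_order] ordLeq_ordLess_trans
    by (auto simp: countable_card_le_natLeq)
  ultimately show False
    using not_ordLess_ordIso by blast
qed

lemma limit_above_countable_omega1:
  assumes "A \<subseteq> Field omega1" "countable A"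
  shows "\<exists>\<alpha>. is_limit \<alpha> \<and> A \<subseteq> underS omega1 \<alpha>"
proof -
  have "\<forall>\<gamma>\<in>Field omega1. \<exists>\<delta>\<in>Field omega1. \<gamma> \<in> underS omega1 \<delta>"
    using countable_bounded_omega1[of "{\<gamma>}" for \<gamma>] by auto
  then obtain f where f: "\<And>\<gamma>. \<gamma> \<in> Field omega1 \<Longrightarrow> f \<gamma> \<in> Field omega1 \<and> \<gamma> \<in> underS omega1 (f \<gamma>)"
    by metis
  obtain \<gamma>0 where \<gamma>0: "\<gamma>0 \<in> Field omega1" "A \<subseteq> underS omega1 \<gamma>0"
    using countable_bounded_omega1[OF assms] by blast
  define S where "S = range (\<lambda>n. (f ^^ n) \<gamma>0)"
  have "(f ^^ n) \<gamma>0 \<in> Field omega1" for n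
    by (induction n) (use \<gamma>0 f in auto)
  then have S: "S \<subseteq> Field omega1" "countable S" "\<gamma>0 \<in> S"
    unfolding S_def by (auto intro: range_eqI[of _ _ 0])
  have fS: "f \<beta> \<in> S" if "\<beta> \<in> S" for \<beta>
    using that unfolding S_def by (auto intro: range_eqI[of _ _ "Suc _"])
  define U where "U = {\<delta>\<in>Field omega1. S \<subseteq> underS omega1 \<delta>}"
  have U: "U \<subseteq> Field omega1" "U \<noteq> {}"
    using countable_bounded_omega1[OF S(1,2)] by (auto simp: U_def)
  define \<alpha> where "\<alpha> = omega1.minim U"
  have \<alpha>: "\<alpha> \<in> Field omega1" "S \<subseteq> underS omega1 \<alpha>"
    using omega1.minim_in[OF U] by (auto simp: \<alpha>_def U_def)
  have "\<not> is_succ \<beta> \<alpha>" for \<beta>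
  proof
    assume succ: "is_succ \<beta> \<alpha>"
    then have \<beta>: "\<beta> \<in> Field omega1" "S \<subseteq> under omega1 \<beta>" "\<beta> \<in> underS omega1 \<alpha>"
      using \<alpha> is_succ_underS by (auto simp: is_succ_def)
    have "\<beta> \<notin> U"
      using omega1.minim_least[OF U(1), of \<beta>] \<beta>(3) omega1.ANTISYM
      unfolding \<alpha>_def[symmetric] underS_def antisym_def by blast
    then have "\<beta> \<in> S"
      using \<beta> unfolding U_def under_def underS_def by blast
    then have "(f \<beta>, \<beta>) \<in> omega1" "\<beta> \<in> underS omega1 (f \<beta>)"
      using fS[of \<beta>] \<beta> f by (auto simp: under_def)
    then show False
      using omega1.ANTISYM unfolding underS_def antisym_def by blast
  qed
  then have "is_limit \<alpha>"
    using \<alpha> S(3) by (auto simp: is_limit_def is_zero_def)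
  moreover have "A \<subseteq> underS omega1 \<alpha>"
    using \<gamma>0(2) \<alpha>(2) S(3) omega1.TRANS omega1.ANTISYM
    unfolding underS_def trans_def antisym_def by blast
  ultimately show ?thesis by blast
qed

lemma H_omega1_Atom [simp]: "Atom q \<in> H_omega1 Q \<longleftrightarrow> q \<in> Q"
proof
  have "q \<in> Q" if "Atom q \<in> HV Q \<alpha>" for \<alpha>
    using that
    by (induction \<alpha> rule: omega1.well_order_induct)
      (subst (asm) (2) HV.simps, auto split: if_splits simp: underS_def)
  then show "Atom q \<in> H_omega1 Q \<Longrightarrow> q \<in> Q"
    by (auto simp: H_omega1_def)
next
  assume "q \<in> Q"
  have "Field omega1 \<noteq> {}"
    using countable_bounded_omega1[of "{}"] by auto
  then have "omega1.minim (Field omega1) \<in> Field omega1"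
    by (simp add: omega1.minim_in)
  moreover from this have "is_zero (omega1.minim (Field omega1))"
    using omega1.minim_least[of "Field omega1"] omega1.ANTISYM
    unfolding is_zero_def underS_def antisym_def Field_def by blast
  ultimately show "Atom q \<in> H_omega1 Q"
    using \<open>q \<in> Q\<close> HV_zero[of _ Q] unfolding H_omega1_def by blast
qed

lemma H_omega1_Set [simp]: "Set X \<in> H_omega1 Q \<longleftrightarrow> rcset X \<noteq> {} \<and> rcset X \<subseteq> H_omega1 Q"
proof
  have "rcset X \<noteq> {} \<and> rcset X \<subseteq> H_omega1 Q" if "Set X \<in> HV Q \<alpha>" for \<alpha>
    using that
  proof (induction \<alpha> rule: omega1.well_order_induct)
    case (1 \<alpha>)
    consider "is_zero \<alpha>" | \<beta> where "is_succ \<beta> \<alpha>" | "is_limit \<alpha>"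
      using 1(2) by (subst (asm) HV.simps) (auto split: if_splits)
    then show ?case
    proof cases
      case 1
      with \<open>Set X \<in> HV Q \<alpha>\<close> show ?thesis by (auto simp: HV_zero)
    next
      case (2 \<beta>)
      then have "rcset X \<noteq> {}" "rcset X \<subseteq> HV Q \<beta>" "\<beta> \<in> Field omega1"
        using 1(2) by (auto simp: HV_succ is_succ_def)
      then show ?thesis unfolding H_omega1_def by blast
    next
      case 3
      with 1 show ?thesis by (auto simp: HV_limit underS_def)
    qed
  qed
  then show "Set X \<in> H_omega1 Q \<Longrightarrow> rcset X \<noteq> {} \<and> rcset X \<subseteq> H_omega1 Q"
    by (auto simp: H_omega1_def)
next
  assume X: "rcset X \<noteq> {} \<and> rcset X \<subseteq> H_omega1 Q"
  then obtain g where g: "\<And>x. x \<in> rcset X \<Longrightarrow> g x \<in> Field omega1 \<and> x \<in> HV Q (g x)"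
    unfolding H_omega1_def by (metis UN_E subsetD)
  then obtain \<alpha> where \<alpha>: "is_limit \<alpha>" "g ` rcset X \<subseteq> underS omega1 \<alpha>"
    using limit_above_countable_omega1[of "g ` rcset X"] by auto
  then have "rcset X \<subseteq> HV Q \<alpha>"
    using g by (auto simp: HV_limit)
  moreover obtain \<delta> where \<delta>: "is_succ \<alpha> \<delta>"
  proof -
    have \<alpha>': "\<alpha> \<in> Field omega1" using \<alpha> by (simp add: is_limit_def)
    have ne: "AboveS omega1 {\<alpha>} \<noteq> {}"
      using countable_bounded_omega1[of "{\<alpha>}"] \<alpha>' by (auto simp: AboveS_def underS_def)
    define \<delta> where "\<delta> = omega1.suc {\<alpha>}"
    have \<delta>: "\<delta> \<in> Field omega1" "\<alpha> \<noteq> \<delta>" "(\<alpha>, \<delta>) \<in> omega1"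
      using \<alpha>' ne omega1.suc_greater[of "{\<alpha>}" \<alpha>] by (auto simp: \<delta>_def omega1.suc_inField)
    have least: "(\<delta>, \<gamma>) \<in> omega1" if "\<gamma> \<in> Field omega1" "\<alpha> \<noteq> \<gamma>" "(\<alpha>, \<gamma>) \<in> omega1" for \<gamma>
      using that omega1.suc_least_AboveS[of \<gamma> "{\<alpha>}"] by (simp add: AboveS_def \<delta>_def)
    have "underS omega1 \<delta> = under omega1 \<alpha>"
    proof (intro equalityI subsetI)
      fix \<gamma> assume "\<gamma> \<in> underS omega1 \<delta>"
      then have \<gamma>: "\<gamma> \<noteq> \<delta>" "(\<gamma>, \<delta>) \<in> omega1" "\<gamma> \<in> Field omega1"
        by (auto simp: underS_def Field_def)
      then have "\<not> (\<alpha> \<noteq> \<gamma> \<and> (\<alpha>, \<gamma>) \<in> omega1)"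
        using least omega1.ANTISYM by (blast dest: antisymD)
      then show "\<gamma> \<in> under omega1 \<alpha>"
        using \<gamma> \<alpha>' omega1.TOTALS unfolding under_def by blast
    next
      fix \<gamma> assume "\<gamma> \<in> under omega1 \<alpha>"
      then show "\<gamma> \<in> underS omega1 \<delta>"
        using \<delta> omega1.TRANS omega1.ANTISYM
        unfolding under_def underS_def trans_def antisym_def by blast
    qed
    then show ?thesis using that \<alpha>' \<delta> by (auto simp: is_succ_def)
  qed
  ultimately have "Set X \<in> HV Q \<delta>"
    using X by (auto simp: HV_succ)
  then show "Set X \<in> H_omega1 Q"
    using \<delta> by (auto simp: H_omega1_def is_succ_def)
qed

lemma quasi_order_on_H_omega1:
  assumes "quasi_order_on Q le"
  shows "quasi_order_on (H_omega1 Q) (le_plus le)"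
proof -
  have refl: "le_plus le x x" if "x \<in> H_omega1 Q" for x
    using that assms
    by (induction x) (auto simp: quasi_order_on_def reflp_on_def)
  have trans: "le_plus le x z"
    if "x \<in> H_omega1 Q" "y \<in> H_omega1 Q" "z \<in> H_omega1 Q" "le_plus le x y" "le_plus le y z"
    for x y z
    using that
  proof (induction z arbitrary: x y)
    case (Atom r)
    then show ?case
      using assms by (cases x; cases y) (auto simp: quasi_order_on_def dest: transp_onD)
  next
    case (Set Z)
    have IH: "le_plus le x' z'"
      if "z' \<in> rcset Z" "le_plus le y' z'" "le_plus le x' y'" "x' \<in> H_omega1 Q" "y' \<in> H_omega1 Q"
      for x' y' z'
      using Set.IH[of z' x' y'] Set.prems(3) that by auto
    show ?case
    proof (cases x; cases y)
      fix p q assume xy: "x = Atom p" "y = Atom q"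
      then show ?thesis
        using Set.prems IH[of _ y x] by auto
    next
      fix p Y assume xy: "x = Atom p" "y = Set Y"
      then obtain y' where "y' \<in> rcset Y" "le_plus le x y'"
        using Set.prems by auto
      moreover have "\<forall>y'\<in>rcset Y. \<exists>z'\<in>rcset Z. le_plus le y' z'"
        using Set.prems xy by simp
      ultimately obtain z' where "z' \<in> rcset Z" "le_plus le y' z'"
        by blast
      with \<open>y' \<in> rcset Y\<close> \<open>le_plus le x y'\<close> show ?thesis
        using Set.prems IH[of z' y' x] xy by auto
    next
      fix X q assume xy: "x = Set X" "y = Atom q"
      then show ?thesis
        using Set.prems by simp
    next
      fix X Y assume xy: "x = Set X" "y = Set Y"
      have "\<exists>z'\<in>rcset Z. le_plus le x' z'" if x': "x' \<in> rcset X" for x'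
      proof -
        have "\<forall>x'\<in>rcset X. \<exists>y'\<in>rcset Y. le_plus le x' y'"
          "\<forall>y'\<in>rcset Y. \<exists>z'\<in>rcset Z. le_plus le y' z'"
          using Set.prems xy by simp_all
        then obtain y' z' where "y' \<in> rcset Y" "le_plus le x' y'" "z' \<in> rcset Z" "le_plus le y' z'"
          using x' by blast
        then show ?thesis
          using IH[of z' y' x'] Set.prems(1,2) xy x' by (simp add: subset_iff) blast
      qed
      then show ?thesis
        using xy by simp
    qed
  qed
  show ?thesis
    using refl trans unfolding quasi_order_on_def reflp_on_def transp_on_def by blast
qed

end

theory Submission
  imports Defs
begin

text \<open>
  The obvious idea is to flatten: an immersion \<open>m\<close> extends to a map from hereditarily countable sets
  over \<open>R\<close> to hereditarily countable sets over \<open>F\<close>. This map need not be an immersion, because it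
  may send an atom to a set, and \<open>\<le>\<^sub>+\<close> treats atoms and sets differently. The proof therefore passes to
  Simpson's form of Nash-Williams' definition, in which the sets disappear. A bad array is a locally
  constant function \<open>f\<close> on the infinite sets of natural numbers with \<open>\<not> f X \<le> f (X - {min X})\<close> for all
  \<open>X\<close>, and a quasi-order is better-quasi-ordered iff no bad array takes its values in it
  (\<open>bqo_on_iff_no_bad_array\<close>). Composition with an immersion preserves bad arrays, so a bad array in
  \<open>R\<close> gives one in \<open>H_omega1 F\<close>.

  What carries the proof is \<open>bad_array_atoms\<close>: a bad array \<open>f\<close> in \<open>H_omega1 Q\<close> gives one in \<open>Q\<close>. If
  \<open>f X\<close> and \<open>f (X - {min X})\<close> are sets, some element of the first is below no element of the second;
  replacing \<open>f X\<close> by such an element, for all \<open>X\<close> at once, keeps badness. Repeating this ends in atoms,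
  after \<open>d X\<close> rounds. The only obstacle is that \<open>f (X - {min X})\<close> may become an atom while \<open>f X\<close> is
  still a set, which happens only if \<open>d X > d (X - {min X})\<close>. As \<open>d\<close> is locally constant, the Ramsey
  theorem for clopen sets gives an infinite set on whose infinite subsets this inequality holds always
  or never, and always is impossible, since \<open>d\<close> would decrease forever.

  Since a bad sequence in \<open>H_omega1 Q\<close> is a bad array that depends on \<open>min X\<close> only, this proves one
  half of the characterisation and also carries the array from \<open>H_omega1 F\<close> to \<open>F\<close>. For
  the other half, a bad array \<open>f\<close> is unfolded into sets: a finite set \<open>s\<close> is sent to the value of \<open>f\<close> if
  the initial segment \<open>s\<close> determines it, and otherwise to the set of the images of the one-point end
  extensions of \<open>s\<close>. The images of \<open>{0}, {1}, {2}, \<dots>\<close> form a bad sequence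
  (\<open>represents_le_plus\<close>).
\<close>

section \<open>Locally constant functions on infinite sets of natural numbers\<close>

text \<open>
  The topology is that of the infinite sets as a subspace of the Cantor space: the sets that agree
  with \<open>X\<close> below some \<open>n\<close> are the basic neighbourhoods of \<open>X\<close>.
\<close>

definition locally_constant :: "(nat set \<Rightarrow> 'b) \<Rightarrow> bool" where
  "locally_constant f \<longleftrightarrow>
     (\<forall>X. infinite X \<longrightarrow> (\<exists>n. \<forall>Y. infinite Y \<longrightarrow> Y \<inter> {..<n} = X \<inter> {..<n} \<longrightarrow> f Y = f X))"

definition tail :: "nat set \<Rightarrow> nat set" where
  "tail X = X - {Inf X}"

definition before :: "nat set \<Rightarrow> nat set \<Rightarrow> bool" where
  "before s Z \<longleftrightarrow> (\<forall>x\<in>s. \<forall>z\<in>Z. x < z)"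

lemma locally_constantD:
  assumes "locally_constant f" "infinite X"
  obtains n where "\<And>Y. infinite Y \<Longrightarrow> Y \<inter> {..<n} = X \<inter> {..<n} \<Longrightarrow> f Y = f X"
  using assms unfolding locally_constant_def by blast

lemma agree_below_mono:
  fixes X Y :: "nat set"
  assumes "Y \<inter> {..<n} = X \<inter> {..<n}" "m \<le> n"
  shows "Y \<inter> {..<m} = X \<inter> {..<m}"
proof -
  have "{..<m} = {..<n} \<inter> {..<m}" using assms(2) by auto
  then show ?thesis using assms(1) by (metis inf_assoc)
qed

lemma infinite_tail: "infinite X \<Longrightarrow> infinite (tail X)"
  by (simp add: tail_def)

lemma tail_subset: "tail X \<subseteq> X"
  by (auto simp: tail_def)

lemma Inf_mem: "infinite X \<Longrightarrow> Inf X \<in> X" for X :: "nat set"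
  by (metis Inf_nat_def1 finite.emptyI)

lemma Inf_less_tail: "x \<in> tail X \<Longrightarrow> Inf X < x"
  unfolding tail_def by (metis DiffE cInf_lower bdd_below_bot insertI1 le_neq_implies_less)

lemma tail_insert:
  assumes "\<And>x. x \<in> X \<Longrightarrow> a < x"
  shows "tail (insert a X) = X"
proof -
  have "Inf (insert a X) = a"
    using assms by (intro cInf_eq_minimum) (auto intro: less_imp_le)
  then show ?thesis using assms by (auto simp: tail_def)
qed

lemma locally_constant_compose2:
  assumes "locally_constant f" "locally_constant g"
  shows "locally_constant (\<lambda>X. h (f X) (g X))"
  unfolding locally_constant_def
proof (intro allI impI)
  fix X :: "nat set" assume X: "infinite X"
  obtain n where n: "\<And>Y. infinite Y \<Longrightarrow> Y \<inter> {..<n} = X \<inter> {..<n} \<Longrightarrow> f Y = f X"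
    using locally_constantD[OF assms(1) X] by blast
  obtain k where k: "\<And>Y. infinite Y \<Longrightarrow> Y \<inter> {..<k} = X \<inter> {..<k} \<Longrightarrow> g Y = g X"
    using locally_constantD[OF assms(2) X] by blast
  have "h (f Y) (g Y) = h (f X) (g X)"
    if "infinite Y" "Y \<inter> {..<max n k} = X \<inter> {..<max n k}" for Y
    using n[of Y] k[of Y] that agree_below_mono[OF that(2)] by simp
  then show "\<exists>n. \<forall>Y. infinite Y \<longrightarrow> Y \<inter> {..<n} = X \<inter> {..<n} \<longrightarrow> h (f Y) (g Y) = h (f X) (g X)"
    by blast
qed

lemma locally_constant_compose: "locally_constant f \<Longrightarrow> locally_constant (\<lambda>X. h (f X))"
  using locally_constant_compose2[of f f "\<lambda>x _. h x"] by simp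

lemma Inf_agree:
  fixes X Y :: "nat set"
  assumes "infinite X" "Y \<inter> {..<n} = X \<inter> {..<n}" "Inf X < n"
  shows "Inf Y = Inf X"
proof (rule cInf_eq_minimum)
  show "Inf X \<in> Y" using assms Inf_mem[OF assms(1)] by blast
  show "Inf X \<le> y" if "y \<in> Y" for y
  proof (cases "y < n")
    case True
    then have "y \<in> X" using that assms(2) by blast
    then show ?thesis by (simp add: cInf_lower)
  qed (use assms(3) in simp)
qed

lemma locally_constant_Inf: "locally_constant Inf"
  unfolding locally_constant_def using Inf_agree by (metis lessI)

lemma locally_constant_tail:
  assumes "locally_constant f"
  shows "locally_constant (\<lambda>X. f (tail X))"
  unfolding locally_constant_def
proof (intro allI impI)
  fix X :: "nat set" assume X: "infinite X"
  obtain n where n: "\<And>Y. infinite Y \<Longrightarrow> Y \<inter> {..<n} = tail X \<inter> {..<n} \<Longrightarrow> f Y = f (tail X)"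
    using locally_constantD[OF assms infinite_tail[OF X]] by blast
  define N where "N = max n (Suc (Inf X))"
  have "f (tail Y) = f (tail X)" if Y: "infinite Y" "Y \<inter> {..<N} = X \<inter> {..<N}" for Y
  proof (rule n)
    show "infinite (tail Y)" using Y by (simp add: infinite_tail)
    have "Inf Y = Inf X" by (rule Inf_agree[OF X Y(2)]) (simp add: N_def)
    moreover have "Y \<inter> {..<n} = X \<inter> {..<n}"
      by (rule agree_below_mono[OF Y(2)]) (simp add: N_def)
    ultimately show "tail Y \<inter> {..<n} = tail X \<inter> {..<n}" by (auto simp: tail_def)
  qed
  then show "\<exists>n. \<forall>Y. infinite Y \<longrightarrow> Y \<inter> {..<n} = X \<inter> {..<n} \<longrightarrow> f (tail Y) = f (tail X)"
    by blast
qed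

lemma locally_constant_select:
  assumes "\<And>k. locally_constant (F k)" "locally_constant d"
  shows "locally_constant (\<lambda>X. F (d X) X)"
  unfolding locally_constant_def
proof (intro allI impI)
  fix X :: "nat set" assume X: "infinite X"
  have "locally_constant (\<lambda>Y. (d Y, F (d X) Y))"
    by (rule locally_constant_compose2[OF assms(2) assms(1)])
  then show "\<exists>n. \<forall>Y. infinite Y \<longrightarrow> Y \<inter> {..<n} = X \<inter> {..<n} \<longrightarrow> F (d Y) Y = F (d X) X"
    using X unfolding locally_constant_def by (metis prod.inject)
qed

text \<open>
  The first index at which some \<open>P k\<close> holds is determined by the finitely many truth values up to that
  index, and these are constant on a common neighbourhood.
\<close>

lemma locally_constant_Least:
  assumes "\<And>k. locally_constant (P k)" "\<And>X. infinite X \<Longrightarrow> \<exists>k :: nat. P k X"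
  shows "locally_constant (\<lambda>X. LEAST k. P k X)"
  unfolding locally_constant_def
proof (intro allI impI)
  fix X :: "nat set" assume X: "infinite X"
  define d where "d = (LEAST k. P k X)"
  have d: "P d X" "\<And>k. k < d \<Longrightarrow> \<not> P k X"
    using assms(2)[OF X] unfolding d_def by (auto intro: LeastI_ex dest: not_less_Least)
  have lc: "locally_constant (\<lambda>Y. map (\<lambda>k. P k Y) [0..<n])" for n
  proof (induction n)
    case 0
    show ?case by (simp add: locally_constant_def)
  next
    case (Suc n)
    show ?case
      using locally_constant_compose2[OF Suc assms(1)[of n], of "\<lambda>xs y. xs @ [y]"] by simp
  qed
  obtain n where n: "\<And>Y. infinite Y \<Longrightarrow> Y \<inter> {..<n} = X \<inter> {..<n} \<Longrightarrow>
      map (\<lambda>k. P k Y) [0..<Suc d] = map (\<lambda>k. P k X) [0..<Suc d]"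
    using locally_constantD[OF lc X, of "Suc d"] by blast
  have "(LEAST k. P k Y) = d" if "infinite Y" "Y \<inter> {..<n} = X \<inter> {..<n}" for Y
  proof -
    have eq: "P k Y = P k X" if "k \<le> d" for k
      using n[OF \<open>infinite Y\<close> \<open>Y \<inter> {..<n} = X \<inter> {..<n}\<close>] that by (auto simp del: upt_Suc)
    show ?thesis
      using eq d by (intro Least_equality) (auto simp: not_less[symmetric])
  qed
  then show "\<exists>n. \<forall>Y. infinite Y \<longrightarrow> Y \<inter> {..<n} = X \<inter> {..<n} \<longrightarrow> (LEAST k. P k Y) = (LEAST k. P k X)"
    unfolding d_def by blast
qed

section \<open>Bar induction and the clopen Ramsey theorem\<close>

text \<open>
  The finite sets \<open>s\<close> are the nodes of the tree of increasing finite sequences, the sets beyond \<open>s\<close> its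
  branches through \<open>s\<close>. Being barred means that the subtree above \<open>s\<close>, cut off where the value of \<open>f\<close> is
  determined, is well-founded; rule induction is then induction along this subtree.
\<close>

inductive barred :: "(nat set \<Rightarrow> 'b) \<Rightarrow> nat set \<Rightarrow> bool" for f where
  decided: "\<forall>Z. infinite Z \<longrightarrow> before s Z \<longrightarrow> f (s \<union> Z) = c \<Longrightarrow> barred f s"
| extend: "(\<And>n. before s {n} \<Longrightarrow> barred f (insert n s)) \<Longrightarrow> barred f s"

text \<open>
  If \<open>s\<close> were not barred, one could keep adding points and reach an infinite set none of whose
  initial segments decides \<open>f\<close>.
\<close>

lemma locally_constant_barred:
  assumes "locally_constant f"
  shows "barred f s"
proof (rule ccontr)
  assume not: "\<not> barred f s"
  have "\<exists>n. before t {n} \<and> \<not> barred f (insert n t)" if "\<not> barred f t" for t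
    using that extend[of t f] by blast
  then obtain g where g: "\<And>t. \<not> barred f t \<Longrightarrow> before t {g t} \<and> \<not> barred f (insert (g t) t)"
    by metis
  define T where "T = rec_nat s (\<lambda>_ t. insert (g t) t)"
  define p where "p k = g (T k)" for k
  have T: "T 0 = s" "\<And>k. T (Suc k) = insert (p k) (T k)"
    by (simp_all add: T_def p_def)
  have not_T: "\<not> barred f (T k)" for k
    by (induction k) (use T not g in \<open>simp_all add: p_def\<close>)
  have p_greater: "x < p k" if "x \<in> T k" for x k
    using g[OF not_T[of k]] that by (simp add: before_def p_def)
  have mono: "T j \<subseteq> T k" if "j \<le> k" for j k
    using that by (rule lift_Suc_mono_le[rotated]) (use T in auto)
  have p_mem: "p j \<in> T k" if "j < k" for j k
    using mono[of "Suc j" k] that T(2)[of j] by auto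
  then have p: "strict_mono p"
    by (intro strict_monoI p_greater)
  have T_eq: "T k = s \<union> p ` {..<k}" for k
    by (induction k) (auto simp: T lessThan_Suc)
  define X where "X = s \<union> range p"
  \<comment> \<open>All sufficiently long initial segments of \<open>X\<close> decide \<open>f\<close>, as \<open>f\<close> is constant near \<open>X\<close>.\<close>
  have "infinite X"
    using range_inj_infinite[OF strict_mono_imp_inj_on[OF p]] by (simp add: X_def)
  then obtain N where N: "\<And>Y. infinite Y \<Longrightarrow> Y \<inter> {..<N} = X \<inter> {..<N} \<Longrightarrow> f Y = f X"
    using locally_constantD[OF assms] by blast
  have "f (T (Suc N) \<union> Z) = f X" if Z: "infinite Z" "before (T (Suc N)) Z" for Z
  proof (rule N)
    show "infinite (T (Suc N) \<union> Z)" using Z by simp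
    have "N \<le> z" if "z \<in> Z" for z
      using Z(2) that p_mem[of N "Suc N"] strict_mono_imp_increasing[OF p, of N]
      unfolding before_def by force
    moreover have "j < Suc N" if "p j < N" for j
      using that strict_mono_imp_increasing[OF p, of j] by simp
    ultimately show "(T (Suc N) \<union> Z) \<inter> {..<N} = X \<inter> {..<N}"
      unfolding T_eq X_def by fastforce
  qed
  then have "barred f (T (Suc N))"
    by (intro decided[of _ f "f X"]) simp
  then show False using not_T by simp
qed

text \<open>
  This is Ramsey's theorem for clopen sets (take \<open>s\<close> empty), proved like the finite one by bar
  induction. If all one-point extensions of \<open>s\<close> have homogeneous sets, a descending sequence of
  such sets has a diagonal on which the colour depends on the first point alone, and the pigeonhole
  principle makes that colour constant.
\<close>

lemma barred_homogeneous:
  fixes P :: "nat set \<Rightarrow> bool"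
  assumes "barred P s" "finite s" "infinite A"
  shows "\<exists>B c. B \<subseteq> A \<and> infinite B \<and> (\<forall>Z\<subseteq>B. infinite Z \<longrightarrow> before s Z \<longrightarrow> P (s \<union> Z) = c)"
  using assms
proof (induction arbitrary: A rule: barred.induct)
  case (decided s c)
  then show ?case by (intro exI[of _ A] exI[of _ c]) simp
next
  case (extend s)
  define good where "good n B c \<longleftrightarrow>
    (\<forall>Z\<subseteq>B. infinite Z \<longrightarrow> before (insert n s) Z \<longrightarrow> P (insert n s \<union> Z) = c)" for n B c
  \<comment> \<open>\<open>S k\<close> is the descending sequence, \<open>p k\<close> the diagonal, and \<open>c k\<close> the colour of the infinite
    subsets of the diagonal that start at \<open>p k\<close>.\<close>
  define A0 where "A0 = {a\<in>A. before s {a}}"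
  have "A - {..Max (insert 0 s)} \<subseteq> A0"
    using \<open>finite s\<close> by (auto simp: A0_def before_def not_le)
  moreover have "infinite (A - {..Max (insert 0 s)})"
    using \<open>infinite A\<close> by simp
  ultimately have A0: "infinite A0" by (metis finite_subset)
  have "\<exists>C c. C \<subseteq> tail B \<and> infinite C \<and> good (Inf B) C c"
    if "infinite B" "B \<subseteq> A0" for B
  proof -
    have "before s {Inf B}" "finite (insert (Inf B) s)"
      using that Inf_mem[of B] \<open>finite s\<close> by (auto simp: A0_def)
    from extend.IH[OF this infinite_tail[OF that(1)]] show ?thesis
      by (simp add: good_def)
  qed
  then have ex: "\<exists>C. C \<subseteq> tail B \<and> infinite C \<and> (\<exists>c. good (Inf B) C c)"
    if "infinite B" "B \<subseteq> A0" for B using that by simp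
  define h where "h B = (SOME C. C \<subseteq> tail B \<and> infinite C \<and> (\<exists>c. good (Inf B) C c))" for B
  have h: "h B \<subseteq> tail B \<and> infinite (h B) \<and> (\<exists>c. good (Inf B) (h B) c)"
    if "infinite B" "B \<subseteq> A0" for B
    unfolding h_def by (rule someI_ex) (rule ex[OF that])
  define S where "S k = (h ^^ k) A0" for k
  have S: "infinite (S k) \<and> S k \<subseteq> A0" for k
  proof (induction k)
    case (Suc k)
    then show ?case using h[of "S k"] tail_subset[of "S k"] by (auto simp: S_def)
  qed (simp add: S_def A0)
  have S_Suc: "S (Suc k) \<subseteq> tail (S k)" "\<exists>c. good (Inf (S k)) (S (Suc k)) c" for k
    using h S[of k] by (simp_all add: S_def)
  then obtain c where c: "\<And>k. good (Inf (S k)) (S (Suc k)) (c k)" by metis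
  define p where "p k = Inf (S k)" for k
  have p_mem: "p k \<in> S k" for k
    using S Inf_mem by (simp add: p_def)
  have antimono: "S k \<subseteq> S j" if "j \<le> k" for j k
    using that by (rule lift_Suc_antimono_le[rotated]) (use S_Suc(1) tail_subset in \<open>rule order_trans\<close>)
  have later: "p k \<in> S (Suc j)" if "j < k" for j k
    using antimono[of "Suc j" k] that p_mem[of k] by auto
  have p: "strict_mono p"
  proof (rule strict_monoI)
    fix j k :: nat assume "j < k"
    then have "p k \<in> tail (S j)" using later S_Suc(1) by blast
    then show "p j < p k" unfolding p_def[of j] by (rule Inf_less_tail)
  qed
  obtain b where b: "infinite {k. c k = b}"
    using pigeonhole_infinite[of "UNIV :: nat set" c] by auto
  define B where "B = p ` {k. c k = b}"
  have inf_B: "infinite B"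
    using b finite_image_iff[OF inj_on_subset[OF strict_mono_imp_inj_on[OF p] subset_UNIV]]
    by (simp add: B_def)
  have "P (s \<union> Z) = b" if Z: "Z \<subseteq> B" "infinite Z" "before s Z" for Z
  proof -
    obtain k where k: "c k = b" "Inf Z = p k"
      using Inf_mem[OF Z(2)] Z(1) unfolding B_def by blast
    have tail_Z: "tail Z \<subseteq> S (Suc k)"
    proof
      fix z assume z: "z \<in> tail Z"
      then obtain j where j: "z = p j"
        using Z(1) tail_subset unfolding B_def by blast
      then have "k < j"
        using Inf_less_tail[OF z] k(2) strict_mono_less[OF p] by simp
      then show "z \<in> S (Suc k)" using later j by simp
    qed
    have "before (insert (p k) s) (tail Z)"
      using Z(3) Inf_less_tail[of _ Z] tail_subset[of Z] k(2) by (auto simp: before_def)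
    then have "P (insert (p k) s \<union> tail Z) = b"
      using c[of k] k(1) tail_Z infinite_tail[OF Z(2)] by (simp add: good_def p_def)
    moreover have "insert (p k) s \<union> tail Z = s \<union> Z"
      using Inf_mem[OF Z(2)] k(2) by (auto simp: tail_def)
    ultimately show ?thesis by simp
  qed
  moreover have "B \<subseteq> A"
    using p_mem S by (auto simp: B_def A0_def)
  ultimately show ?case using inf_B by (intro exI[of _ B] exI[of _ b]) simp
qed

text \<open>
  By the Ramsey theorem the inequality holds for all or for no infinite subsets of a suitable \<open>A\<close>. A
  failure on a whole homogeneous set would make the values along its iterated tails descend
  forever.
\<close>

lemma locally_constant_nondecreasing_on_tails:
  fixes d :: "nat set \<Rightarrow> nat"
  assumes "locally_constant d"
  shows "\<exists>A. infinite A \<and> (\<forall>X\<subseteq>A. infinite X \<longrightarrow> d X \<le> d (tail X))"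
proof -
  let ?P = "\<lambda>X. d X \<le> d (tail X)"
  have "locally_constant ?P"
    by (rule locally_constant_compose2[OF assms locally_constant_tail[OF assms]])
  from barred_homogeneous[OF locally_constant_barred[OF this] finite.emptyI infinite_UNIV_nat]
  obtain A c where "infinite A"
    and "\<forall>Z\<subseteq>A. infinite Z \<longrightarrow> before {} Z \<longrightarrow> ?P ({} \<union> Z) = c"
    by (elim exE conjE)
  then have A: "infinite A" "\<And>X. X \<subseteq> A \<Longrightarrow> infinite X \<Longrightarrow> ?P X = c"
    by (simp_all add: before_def)
  have c
  proof (rule ccontr)
    assume "\<not> c"
    then have descend: "d (tail X) < d X" if "X \<subseteq> A" "infinite X" for X
      using A(2)[OF that] by simp
    have False if "X \<subseteq> A" "infinite X" for X
      using that
    proof (induction "d X" arbitrary: X rule: less_induct)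
      case less
      show ?case
        using less.hyps[OF descend[OF less.prems]] less.prems tail_subset[of X] infinite_tail[of X]
        by auto
    qed
    then show False using A(1) by blast
  qed
  then show ?thesis using A by blast
qed

section \<open>Bad arrays\<close>

definition bad_array :: "'a set \<Rightarrow> ('a \<Rightarrow> 'a \<Rightarrow> bool) \<Rightarrow> (nat set \<Rightarrow> 'a) \<Rightarrow> bool" where
  "bad_array Q le f \<longleftrightarrow> locally_constant f \<and>
     (\<forall>X. infinite X \<longrightarrow> f X \<in> Q \<and> \<not> le (f X) (f (tail X)))"

lemma bad_array_of_bad_sequence:
  assumes "\<And>n. x n \<in> Q" "\<And>i j. i < j \<Longrightarrow> \<not> le (x i) (x j)"
  shows "bad_array Q le (\<lambda>X. x (Inf X))"
proof -
  have "Inf X < Inf (tail X)" if "infinite X" for X :: "nat set"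
    using that by (intro Inf_less_tail Inf_mem infinite_tail)
  then show ?thesis
    using assms locally_constant_compose[OF locally_constant_Inf] by (auto simp: bad_array_def)
qed

lemma bad_array_compose_immersion:
  assumes "immersion R leR Q leQ m" "bad_array R leR f"
  shows "bad_array Q leQ (\<lambda>X. m (f X))"
proof -
  have "m (f X) \<in> Q \<and> \<not> leQ (m (f X)) (m (f (tail X)))" if X: "infinite X" for X
  proof -
    have "f X \<in> R" "f (tail X) \<in> R" "\<not> leR (f X) (f (tail X))"
      using assms(2) X infinite_tail[OF X] by (simp_all add: bad_array_def)
    then show ?thesis using assms(1) by (auto simp: immersion_def)
  qed
  moreover have "locally_constant (\<lambda>X. m (f X))"
    by (rule locally_constant_compose) (use assms(2) in \<open>simp add: bad_array_def\<close>)
  ultimately show ?thesis by (simp add: bad_array_def)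
qed

text \<open>
  An array that is bad only on the infinite subsets of \<open>A\<close> is bad everywhere after the increasing
  enumeration of \<open>A\<close> has been used to rename the natural numbers.
\<close>

lemma bad_array_reindex:
  assumes lc: "locally_constant f" and A: "infinite A"
    and bad: "\<And>X. X \<subseteq> A \<Longrightarrow> infinite X \<Longrightarrow> f X \<in> Q \<and> \<not> le (f X) (f (tail X))"
  shows "\<exists>g. bad_array Q le g"
proof -
  define e where "e = enumerate A"
  have e: "strict_mono e" "range e \<subseteq> A"
    using A strict_mono_enumerate range_enumerate unfolding e_def by auto
  have inj: "inj e" by (rule strict_mono_imp_inj_on[OF e(1)])
  have inf: "infinite (e ` X)" if "infinite X" for X
    using that finite_image_iff[OF inj_on_subset[OF inj subset_UNIV]] by simp
  have e_tail: "e ` tail X = tail (e ` X)" if X: "infinite X" for X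
  proof -
    have "Inf (e ` X) = e (Inf X)"
      using Inf_mem[OF X] by (intro cInf_eq_minimum) (auto simp: strict_mono_less_eq[OF e(1)] cInf_lower)
    then show ?thesis
      using image_set_diff[OF inj] by (simp add: tail_def)
  qed
  have "locally_constant (\<lambda>X. f (e ` X))"
    unfolding locally_constant_def
  proof (intro allI impI)
    fix X :: "nat set" assume X: "infinite X"
    obtain n where n: "\<And>Y. infinite Y \<Longrightarrow> Y \<inter> {..<n} = e ` X \<inter> {..<n} \<Longrightarrow> f Y = f (e ` X)"
      using locally_constantD[OF lc inf[OF X]] by blast
    have "f (e ` Y) = f (e ` X)" if "infinite Y" "Y \<inter> {..<n} = X \<inter> {..<n}" for Y
    proof (rule n[OF inf[OF that(1)]])
      have "e ` Y \<inter> {..<n} = e ` (Y \<inter> {..<n}) \<inter> {..<n}" for Y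
        using strict_mono_imp_increasing[OF e(1)] by (force intro: le_less_trans)
      then show "e ` Y \<inter> {..<n} = e ` X \<inter> {..<n}" using that(2) by metis
    qed
    then show "\<exists>n. \<forall>Y. infinite Y \<longrightarrow> Y \<inter> {..<n} = X \<inter> {..<n} \<longrightarrow> f (e ` Y) = f (e ` X)"
      by (intro exI[of _ n]) blast
  qed
  moreover have "f (e ` X) \<in> Q \<and> \<not> le (f (e ` X)) (f (e ` tail X))" if "infinite X" for X
  proof -
    have "e ` X \<subseteq> A" using e(2) by blast
    from bad[OF this inf[OF that]] show ?thesis by (simp add: e_tail[OF that])
  qed
  ultimately have "bad_array Q le (\<lambda>X. f (e ` X))" by (simp add: bad_array_def)
  then show ?thesis by blast
qed

section \<open>From bad arrays of sets to bad arrays of atoms\<close>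

fun elems :: "'a hcset \<Rightarrow> 'a hcset set" where
  "elems (Atom p) = {}"
| "elems (Set X) = rcset X"

fun is_atom :: "'a hcset \<Rightarrow> bool" where
  "is_atom (Atom p) = True"
| "is_atom (Set X) = False"

text \<open>
  The choice of a witness for \<open>\<not> x \<le>\<^sub>+ y\<close> when both are sets. In all other cases the only point is that
  the result is \<open>x\<close> itself or an element of it, so that iterated descent reaches an atom.
\<close>

fun descend :: "('a \<Rightarrow> 'a \<Rightarrow> bool) \<Rightarrow> 'a hcset \<Rightarrow> 'a hcset \<Rightarrow> 'a hcset" where
  "descend le (Atom p) y = Atom p"
| "descend le (Set X) y =
    (if \<exists>x\<in>rcset X. \<forall>y'\<in>elems y. \<not> le_plus le x y'
     then SOME x. x \<in> rcset X \<and> (\<forall>y'\<in>elems y. \<not> le_plus le x y')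
     else SOME x. x \<in> rcset X)"

lemma descend_mem: "rcset X \<noteq> {} \<Longrightarrow> descend le (Set X) y \<in> rcset X"
  by (auto intro: someI2_ex simp: some_in_eq)

lemma descend_in_H_omega1:
  assumes "x \<in> H_omega1 Q"
  shows "descend le x y \<in> H_omega1 Q"
proof (cases x)
  case (Set X)
  then have "rcset X \<noteq> {}" "rcset X \<subseteq> H_omega1 Q" using assms by simp_all
  then show ?thesis using descend_mem Set by blast
qed (use assms in simp)

text \<open>
  The second element need only be replaced by some element of itself, so the array may be descended
  at \<open>X\<close> and at \<open>X - {min X}\<close> simultaneously. The case of a set and an atom is excluded because
  a set is never below an atom, while its elements may be.
\<close>

lemma descend_not_le:
  assumes "\<not> le_plus le x y" "y \<in> H_omega1 Q" "is_atom y \<longrightarrow> is_atom x"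
  shows "\<not> le_plus le (descend le x y) (descend le y z)"
proof (cases y)
  case (Atom q)
  then show ?thesis using assms by (cases x) auto
next
  case (Set Y)
  then have mem: "descend le y z \<in> rcset Y"
    using assms(2) descend_mem[of Y le z] by (simp del: descend.simps)
  show ?thesis
  proof (cases x)
    case (Atom p)
    then show ?thesis using assms(1) Set mem by (simp del: descend.simps(2))
  next
    case (Set X)
    then have ex: "\<exists>x'\<in>rcset X. \<forall>y'\<in>elems y. \<not> le_plus le x' y'"
      using assms(1) \<open>y = hcset.Set Y\<close> by auto
    then have "descend le x y = (SOME x'. x' \<in> rcset X \<and> (\<forall>y'\<in>elems y. \<not> le_plus le x' y'))"
      using Set by simp
    then have "\<forall>y'\<in>rcset Y. \<not> le_plus le (descend le x y) y'"
      using someI_ex[OF ex[unfolded Bex_def]] \<open>y = hcset.Set Y\<close> by simp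
    then show ?thesis using mem by blast
  qed
qed

text \<open>
  \<open>F k\<close> is the array after \<open>k\<close> descents and \<open>d X\<close> is the number of descents until \<open>X\<close> has an atom.
  Restricted to infinite subsets of a set on which \<open>d X \<le> d (tail X)\<close> always holds, every \<open>F k\<close> is bad, and
  after \<open>d (tail X)\<close> descents both values are atoms.
\<close>

lemma bad_array_atoms:
  assumes "bad_array (H_omega1 Q) (le_plus le) f"
  shows "\<exists>g. bad_array Q le g"
proof -
  define F where "F = rec_nat f (\<lambda>_ g X. descend le (g X) (g (tail X)))"
  have F: "F 0 = f" "\<And>k X. F (Suc k) X = descend le (F k X) (F k (tail X))"
    by (simp_all add: F_def)
  have lc_F: "locally_constant (F k)" for k
  proof (induction k)
    case 0
    then show ?case using assms by (simp add: F bad_array_def)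
  next
    case (Suc k)
    have "F (Suc k) = (\<lambda>X. descend le (F k X) (F k (tail X)))" by (simp add: F fun_eq_iff)
    then show ?case
      using locally_constant_compose2[OF Suc locally_constant_tail[OF Suc]] by simp
  qed
  have in_H: "F k X \<in> H_omega1 Q" if "infinite X" for k X
    by (induction k) (use assms that in \<open>auto simp: F bad_array_def descend_in_H_omega1\<close>)
  have "\<exists>j. is_atom (F j X)" if "infinite X" for X
  proof -
    have "\<exists>j. is_atom (F j X)" if "F k X = x" for x k
      using that
    proof (induction x arbitrary: k)
      case (Atom p)
      then show ?case by (metis is_atom.simps(1))
    next
      case (Set S)
      then have "F (Suc k) X \<in> rcset S"
        using in_H[OF \<open>infinite X\<close>, of k] descend_mem[of S] by (simp add: F del: descend.simps)
      then show ?case using Set.IH by blast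
    qed
    then show ?thesis by blast
  qed
  note ex_atom = this
  define d where "d X = (LEAST k. is_atom (F k X))" for X
  have lc_d: "locally_constant d"
    unfolding d_def
    by (rule locally_constant_Least) (use locally_constant_compose[OF lc_F] ex_atom in auto)
  have stays: "F (k + j) X = F k X" if "is_atom (F k X)" for k j X
  proof (induction j)
    case (Suc j)
    then show ?case using that by (cases "F k X") (simp_all add: F)
  qed simp
  have atom_iff: "is_atom (F k X) \<longleftrightarrow> d X \<le> k" if "infinite X" for k X
  proof
    show "is_atom (F k X) \<Longrightarrow> d X \<le> k"
      by (simp add: d_def Least_le)
    have "is_atom (F (d X) X)"
      unfolding d_def using ex_atom[OF that] by (rule LeastI_ex)
    then show "d X \<le> k \<Longrightarrow> is_atom (F k X)"
      using stays[of "d X" X "k - d X"] by simp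
  qed
  obtain A where A: "infinite A" "\<And>X. X \<subseteq> A \<Longrightarrow> infinite X \<Longrightarrow> d X \<le> d (tail X)"
    using locally_constant_nondecreasing_on_tails[OF lc_d] by blast
  have bad: "\<not> le_plus le (F k X) (F k (tail X))" if "X \<subseteq> A" "infinite X" for k X
    using that
  proof (induction k arbitrary: X)
    case 0
    then show ?case using assms by (simp add: F bad_array_def)
  next
    case (Suc k)
    have "is_atom (F k (tail X)) \<longrightarrow> is_atom (F k X)"
      using A(2)[OF Suc.prems] Suc.prems(2) infinite_tail by (simp add: atom_iff)
    with Suc.IH[OF Suc.prems] in_H[OF infinite_tail[OF Suc.prems(2)]] show ?case
      unfolding F(2) by (rule descend_not_le)
  qed
  define g where "g X = (THE q. F (d X) X = Atom q)" for X
  have g: "F (d X) X = Atom (g X)" if "infinite X" for X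
    using atom_iff[OF that, of "d X"] by (cases "F (d X) X") (auto simp: g_def)
  show ?thesis
  proof (rule bad_array_reindex)
    show "locally_constant g"
      unfolding g_def
      by (rule locally_constant_compose[OF locally_constant_select[OF lc_F lc_d]])
    show "infinite A" by (rule A(1))
    show "g X \<in> Q \<and> \<not> le (g X) (g (tail X))" if X: "X \<subseteq> A" "infinite X" for X
    proof
      show "g X \<in> Q"
        using in_H[OF X(2), of "d X"] g[OF X(2)] by simp
      have "F (d (tail X)) X = Atom (g X)"
        using stays[of "d X" X "d (tail X) - d X"] A(2)[OF X] g[OF X(2)] by simp
      then show "\<not> le (g X) (g (tail X))"
        using bad[OF X, of "d (tail X)"] g[OF infinite_tail[OF X(2)]] by simp
    qed
  qed
qed

section \<open>From bad arrays to bad sequences of sets\<close>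

text \<open>
  The unfolding is a relation, since a set of increasing sequences may be decided and still be
  unfolded further: \<open>leaf\<close> and \<open>node\<close> overlap. Any choice serves for the bad sequence.
\<close>

inductive represents :: "(nat set \<Rightarrow> 'a) \<Rightarrow> nat set \<Rightarrow> 'a hcset \<Rightarrow> bool" for f where
  leaf: "\<forall>Z. infinite Z \<longrightarrow> before s Z \<longrightarrow> f (s \<union> Z) = c \<Longrightarrow> represents f s (Atom c)"
| node: "rcset X = g ` {n. before s {n}} \<Longrightarrow> (\<And>n. before s {n} \<Longrightarrow> represents f (insert n s) (g n)) \<Longrightarrow>
    represents f s (Set X)"

lemma barred_represents: "barred f s \<Longrightarrow> \<exists>x. represents f s x"
proof (induction rule: barred.induct)
  case (decided s c)
  then have "represents f s (Atom c)" by (rule leaf)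
  then show ?case ..
next
  case (extend s)
  then obtain g where "\<And>n. before s {n} \<Longrightarrow> represents f (insert n s) (g n)" by metis
  moreover have "rcset (acset (g ` {n. before s {n}})) = g ` {n. before s {n}}"
    by (simp add: acset_inverse)
  ultimately have "represents f s (Set (acset (g ` {n. before s {n}})))"
    using node by metis
  then show ?case ..
qed

lemma infinite_beyond:
  assumes "finite s"
  obtains Z where "infinite Z" "before s Z"
proof
  show "infinite {Suc (Max (insert 0 s))..}" by (rule infinite_Ici)
  show "before s {Suc (Max (insert 0 s))..}"
    using assms by (auto simp: before_def Suc_le_eq intro: le_less_trans[OF Max_ge])
qed

lemma represents_in_H_omega1:
  assumes "represents f s x" "finite s" "\<And>X. infinite X \<Longrightarrow> f X \<in> Q"
  shows "x \<in> H_omega1 Q"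
  using assms(1,2)
proof induction
  case (leaf s c)
  obtain Z where "infinite Z" "before s Z" using infinite_beyond[OF leaf(2)] .
  then show ?case using leaf(1) assms(3)[of "s \<union> Z"] by auto
next
  case (node X g s)
  obtain Z where Z: "infinite Z" "before s Z" using infinite_beyond[OF node(4)] .
  then have "before s {Inf Z}" using Inf_mem by (auto simp: before_def)
  then show ?case using node by auto
qed

lemma represents_Atom:
  assumes "represents f s (Atom c)" "infinite Z" "before s Z"
  shows "f (s \<union> Z) = c"
  using assms(1)
proof cases
  case leaf
  then show ?thesis using assms(2,3) by simp
qed

lemma represents_Set:
  assumes "represents f s (Set X)"
  shows "\<exists>g. rcset X = g ` {n. before s {n}} \<and>
    (\<forall>n. before s {n} \<longrightarrow> represents f (insert n s) (g n))"
  using assms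
proof cases
  case (node g)
  then show ?thesis by (intro exI[of _ g]) simp
qed

text \<open>
  Think of \<open>\<le>\<^sub>+\<close> as a game in which an element of \<open>x\<close> is answered by an element of \<open>y\<close>. The invariant is
  that \<open>y\<close> belongs to the node of \<open>x\<close> with its minimum \<open>a\<close> deleted and one further point \<open>b\<close> added on
  top. Extending the left node by \<open>b\<close> and the right one by the point of the answer restores it. When
  the game has reached atoms, both nodes are initial segments of \<open>X\<close> and \<open>tail X\<close>, for one and the
  same \<open>X\<close>, so \<open>f\<close> is not bad at \<open>X\<close>.
\<close>

lemma represents_le_plus:
  assumes "le_plus le x y" "represents f (insert a w) x" "represents f (insert b w) y"
    and "finite w" "before {a} (insert b w)" "before w {b}"
  shows "\<exists>X. infinite X \<and> le (f X) (f (tail X))"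
  using assms
proof (induction y arbitrary: x b w rule: hcset.induct)
  case (Atom q)
  then obtain p where p: "x = Atom p" "le p q" by (cases x) auto
  obtain Z where Z: "infinite Z" "before (insert a (insert b w)) Z"
    using infinite_beyond[of "insert a (insert b w)"] Atom.prems(4) by auto
  have Z': "before (insert a w) (insert b Z)" "before (insert b w) Z"
    using Z(2) Atom.prems(5,6) unfolding before_def by auto
  define X where "X = insert a (insert b w \<union> Z)"
  have "tail X = insert b w \<union> Z"
    unfolding X_def using Z(2) Atom.prems(5) by (intro tail_insert) (auto simp: before_def)
  then have tail: "f (tail X) = q"
    using represents_Atom[OF Atom.prems(3) Z(1) Z'(2)] by simp
  have "f X = p"
    using represents_Atom[of f "insert a w" p "insert b Z"] Atom.prems(2) p(1) Z(1) Z'(1)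
    by (simp add: X_def insert_commute)
  with tail p(2) have "le (f X) (f (tail X))" by simp
  moreover have "infinite X" using Z(1) by (simp add: X_def)
  ultimately show ?case by blast
next
  case (Set Y)
  obtain h where h: "rcset Y = h ` {n. before (insert b w) {n}}"
    "\<forall>n. before (insert b w) {n} \<longrightarrow> represents f (insert n (insert b w)) (h n)"
    using represents_Set[OF Set.prems(3)] by (elim exE conjE)
  have b: "before (insert a w) {b}"
    using Set.prems(5,6) by (auto simp: before_def)
  have "\<exists>x'. represents f (insert a (insert b w)) x' \<and> (\<exists>y\<in>rcset Y. le_plus le x' y)"
  proof (cases x)
    case (Atom p)
    \<comment> \<open>An atom passes unchanged to the extended node, which decides \<open>f\<close> with the same value.\<close>
    have "represents f (insert a (insert b w)) (Atom p)"
    proof (rule leaf, intro allI impI)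
      fix Z assume Z: "infinite Z" "before (insert a (insert b w)) Z"
      then have "before (insert a w) (insert b Z)"
        using b by (auto simp: before_def)
      then show "f (insert a (insert b w) \<union> Z) = p"
        using represents_Atom[of f "insert a w" p "insert b Z"] Set.prems(2) Atom Z(1)
        by (simp add: insert_commute)
    qed
    then show ?thesis using Set.prems(1) Atom by auto
  next
    case (Set X)
    then have "represents f (insert a w) (hcset.Set X)" using Set.prems(2) by simp
    from represents_Set[OF this] obtain g where g: "rcset X = g ` {n. before (insert a w) {n}}"
      "\<forall>n. before (insert a w) {n} \<longrightarrow> represents f (insert n (insert a w)) (g n)"
      by (elim exE conjE)
    have "g b \<in> rcset X" using g(1) b by blast
    then show ?thesis
      using g(2)[rule_format, OF b] Set.prems(1) Set by (auto simp: insert_commute)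
  qed
  then obtain x' n where n: "represents f (insert a (insert b w)) x'" "before (insert b w) {n}"
    "le_plus le x' (h n)"
    unfolding h(1) by blast
  show ?case
  proof (rule Set.IH)
    show "h n \<in> rcset Y" using h(1) n(2) by blast
    show "le_plus le x' (h n)" by (rule n(3))
    show "represents f (insert a (insert b w)) x'" by (rule n(1))
    show "represents f (insert n (insert b w)) (h n)" by (rule h(2)[rule_format, OF n(2)])
    show "before {a} (insert n (insert b w))"
      using n(2) Set.prems(5) by (auto simp: before_def)
  qed (use n(2) Set.prems(4) in auto)
qed

lemma bad_sequence_of_bad_array:
  assumes "bad_array Q le f"
  shows "\<exists>x :: nat \<Rightarrow> 'a hcset. (\<forall>n. x n \<in> H_omega1 Q) \<and> (\<forall>i j. i < j \<longrightarrow> \<not> le_plus le (x i) (x j))"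
proof -
  have "\<forall>n. \<exists>x. represents f {n} x"
    using assms locally_constant_barred barred_represents unfolding bad_array_def by blast
  then obtain x where x: "\<And>n. represents f {n} (x n)" by metis
  have "x n \<in> H_omega1 Q" for n
    using represents_in_H_omega1[OF x] assms by (auto simp: bad_array_def)
  moreover have "\<not> le_plus le (x i) (x j)" if "i < j" for i j
    using represents_le_plus[of le "x i" "x j" f i "{}" j] x that assms
    by (auto simp: before_def bad_array_def)
  ultimately show ?thesis by blast
qed

theorem bqo_on_iff_no_bad_array:
  "bqo_on Q le \<longleftrightarrow> quasi_order_on Q le \<and> (\<nexists>f. bad_array Q le f)"
proof (cases "quasi_order_on Q le")
  case True
  have "wqo_on (H_omega1 Q) (le_plus le) \<longleftrightarrow> (\<nexists>f. bad_array Q le f)"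
  proof
    assume wqo: "wqo_on (H_omega1 Q) (le_plus le)"
    show "\<nexists>f. bad_array Q le f"
    proof
      assume "\<exists>f. bad_array Q le f"
      then obtain x where "\<forall>n. x n \<in> H_omega1 Q"
        "\<forall>i j :: nat. i < j \<longrightarrow> \<not> le_plus le (x i) (x j)"
        using bad_sequence_of_bad_array by (elim exE) blast
      then show False using wqo by (simp add: wqo_on_def) blast
    qed
  next
    assume none: "\<nexists>f. bad_array Q le f"
    have "\<exists>i j. i < j \<and> le_plus le (x i) (x j)" if "\<And>n. x n \<in> H_omega1 Q" for x :: "nat \<Rightarrow> _"
    proof (rule ccontr)
      assume "\<not> ?thesis"
      then have "bad_array (H_omega1 Q) (le_plus le) (\<lambda>X. x (Inf X))"
        using that by (intro bad_array_of_bad_sequence) auto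
      then show False using bad_array_atoms none by blast
    qed
    then show "wqo_on (H_omega1 Q) (le_plus le)"
      using quasi_order_on_H_omega1[OF True] by (simp add: wqo_on_def)
  qed
  then show ?thesis using True by (simp add: bqo_on_def)
qed (simp add: bqo_on_def)

theorem corollary11p8:
  fixes R :: "'r set" and leR :: "'r \<Rightarrow> 'r \<Rightarrow> bool"
    and F :: "'f set" and leF :: "'f \<Rightarrow> 'f \<Rightarrow> bool"
    and m :: "'r \<Rightarrow> 'f hcset"
  assumes "quasi_order_on R leR" and "quasi_order_on F leF"
    and "bqo_on F leF"
    and "immersion R leR (H_omega1 F) (le_plus leF) m"
  shows "bqo_on R leR"
proof -
  have "\<not> bad_array R leR f" for f
    using bad_array_compose_immersion[OF assms(4), of f] bad_array_atoms[of F leF] assms(3)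
    unfolding bqo_on_iff_no_bad_array by blast
  then show ?thesis
    using assms(1) by (simp add: bqo_on_iff_no_bad_array)
qed

end
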